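(* Let $E$ be a Banach space and let $\mathcal{F}$ be a commuting family of nonexpansive mappings from $E$ to itself. Suppose $X$ is a nonempty subset of $E$ such that $TX\subset X$ for all $T\in\mathcal{F}$, and suppose there is a vector $x_0\in X$ such that $$\lim_{n\to\infty}\|T^n x_0-T^{n+1}x_0\|=0\quad\text{for all } T\in\mathcal{F}.$$ Then there exists a metric functional $\mathbf{h}\in X^{\diamondsuit}$ that is subinvariant for all $T\in\mathcal{F}$, i.e. $\mathbf{h}(Tx)\le\mathbf{h}(x)$ for all $x\in E$ and all $T\in\mathcal{F}$.
   Context: Banach spaces are real. A mapping $T:E\to E$ is nonexpansive if $\|Tx-Ty\|\le\|x-y\|$ for all $x,y\in E$. The family $\mathcal{F}$ is commuting if $TU=UT$ for all $T,U\in\mathcal{F}$. Metric functionals: fix a base point $o\in E$. For $w\in E$ define $\mathbf{h}_w:E\to\mathbb{R}$ by $\mathbf{h}_w(x)=\|x-w\|-\|o-w\|$. Equip $\mathbb{R}^E$ (all functions $E\to\mathbb{R}$) with the topology of pointwise convergence. $E^{\diamondsuit}$ is the closure of $\{\mathbf{h}_w : w\in E\}$ in $\mathbb{R}^E$. For a subset $X\subset E$, $X^{\diamondsuit}\subset E^{\diamondsuit}$ is the closure of $\{\mathbf{h}_w : w\in X\}$ in $\mathbb{R}^E$ (so its elements are functions on all of $E$). The elements of these sets are called metric functionals. *)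

theory Defs
  imports "HOL-Analysis.Analysis"
begin

definition nonexpansive :: "('a::real_normed_vector \<Rightarrow> 'a) \<Rightarrow> bool" where
  "nonexpansive T \<longleftrightarrow> (\<forall>x y. norm (T x - T y) \<le> norm (x - y))"

definition commuting_family :: "('a \<Rightarrow> 'a) set \<Rightarrow> bool" where
  "commuting_family F \<longleftrightarrow> (\<forall>T\<in>F. \<forall>U\<in>F. T \<circ> U = U \<circ> T)"

text \<open>The point \<open>b\<close> is the base point (written $o$ in the literature).\<close>

definition internal_functional :: "'a::real_normed_vector \<Rightarrow> 'a \<Rightarrow> ('a \<Rightarrow> real)" where
  "internal_functional b w = (\<lambda>x. norm (x - w) - norm (b - w))"

text \<open>
  The closure is taken in the function type \<open>'a \<Rightarrow> real\<close>, whose topology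
  (from \<open>HOL-Analysis.Function_Topology\<close>) is the product topology,
  that is, pointwise convergence on the whole space, also when \<open>X\<close> is a proper subset.
\<close>

definition metric_functionals :: "'a::real_normed_vector \<Rightarrow> 'a set \<Rightarrow> ('a \<Rightarrow> real) set" where
  "metric_functionals b X = closure (internal_functional b ` X)"

end

theory Submission
  imports Defs
begin

text \<open>
  If \<open>w\<close> is moved by at most \<open>e\<close> under a nonexpansive map \<open>T\<close>, then
  \<open>\<parallel>T x - w\<parallel> \<le> \<parallel>T x - T w\<parallel> + \<parallel>T w - w\<parallel> \<le> \<parallel>x - w\<parallel> + e\<close>, so the internal functional of \<open>w\<close> is
  subinvariant under \<open>T\<close> up to the error \<open>e\<close>.
  It therefore suffices to find approximate fixed points that finitely many maps share, and to
  pass to a limit.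

  For a single map the orbit of \<open>x0\<close> supplies approximate fixed points. For several maps
  \<open>T\<^sub>1, \<dots>, T\<^sub>k\<close> the point \<open>w = T\<^sub>1\<^bsup>n\<^sub>1\<^esup> \<cdots> T\<^sub>k\<^bsup>n\<^sub>k\<^esup> x0\<close> works once all exponents are large: by
  commutativity \<open>T\<^sub>i w\<close> and \<open>w\<close> are the images of two consecutive points of the \<open>T\<^sub>i\<close>-orbit of
  \<open>x0\<close> under one nonexpansive map (\<open>common_approximate_fixed_point\<close>).

  The internal functionals are bounded pointwise by \<open>\<parallel>x - b\<parallel>\<close>, so by Tychonoff the metric
  functionals form a compact set (\<open>compact_metric_functionals\<close>). For each map and each \<open>e > 0\<close>
  the functions subinvariant up to \<open>e\<close> form a closed set. Finitely many of these sets meet the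
  metric functionals, hence all of them do, in a functional that is subinvariant up to every
  positive error.
\<close>

lemma nonexpansiveD: "nonexpansive T \<Longrightarrow> norm (T x - T y) \<le> norm (x - y)"
  by (simp add: nonexpansive_def)

lemma nonexpansive_funpow:
  assumes "nonexpansive T"
  shows "nonexpansive (T ^^ n)"
proof (induction n)
  case 0
  show ?case by (simp add: nonexpansive_def)
next
  case (Suc n)
  show ?case
    unfolding nonexpansive_def funpow.simps o_apply
    using nonexpansiveD[OF assms] nonexpansiveD[OF Suc] order_trans by blast
qed

lemma funpow_commute:
  assumes "T \<circ> U = U \<circ> T"
  shows "(T ^^ n) (U x) = U ((T ^^ n) x)"
  using assms by (induction n) (simp_all add: fun_eq_iff)

lemma funpow_mem:
  assumes "T ` X \<subseteq> X" "x \<in> X"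
  shows "(T ^^ n) x \<in> X"
  using assms by (induction n) auto

definition asymptotically_regular_at :: "('a::real_normed_vector \<Rightarrow> 'a) \<Rightarrow> 'a \<Rightarrow> bool" where
  "asymptotically_regular_at T x \<longleftrightarrow> (\<lambda>n. norm ((T ^^ n) x - (T ^^ Suc n) x)) \<longlonglongrightarrow> 0"

text \<open>A nonexpansive map that commutes with \<open>T\<close> carries the \<open>T\<close>-orbit of \<open>x\<close> to that of the image
  point without increasing any step.\<close>

lemma asymptotically_regular_at_image:
  assumes V: "nonexpansive V" and comm: "T \<circ> V = V \<circ> T"
    and reg: "asymptotically_regular_at T x"
  shows "asymptotically_regular_at T (V x)"
  unfolding asymptotically_regular_at_def
proof (rule tendsto_sandwich[OF _ _ tendsto_const])
  show "(\<lambda>n. norm ((T ^^ n) x - (T ^^ Suc n) x)) \<longlonglongrightarrow> 0"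
    using reg by (simp only: asymptotically_regular_at_def)
  show "\<forall>\<^sub>F n in sequentially. norm ((T ^^ n) (V x) - (T ^^ Suc n) (V x))
          \<le> norm ((T ^^ n) x - (T ^^ Suc n) x)"
    by (simp only: funpow_commute[OF comm] nonexpansiveD[OF V] eventually_True)
qed simp

text \<open>Maps are treated one at a time: replacing \<open>w\<close> by \<open>(T ^^ n) w\<close> for large \<open>n\<close> makes it almost
  fixed by \<open>T\<close> and does not spoil what was achieved for the other maps. The induction also carries
  asymptotic regularity of the whole family at \<open>w\<close>, because the next map is iterated from \<open>w\<close>
  and no longer from \<open>x0\<close>.\<close>

lemma common_approximate_fixed_point:
  assumes comm: "commuting_family F"
    and nonexp: "\<And>T. T \<in> F \<Longrightarrow> nonexpansive T"
    and inv: "\<And>T. T \<in> F \<Longrightarrow> T ` X \<subseteq> X"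
    and x0: "x0 \<in> X"
    and reg: "\<And>T. T \<in> F \<Longrightarrow> asymptotically_regular_at T x0"
    and "finite S" "S \<subseteq> F" and e: "e > 0"
  shows "\<exists>w\<in>X. (\<forall>T\<in>F. asymptotically_regular_at T w) \<and> (\<forall>T\<in>S. norm (T w - w) \<le> e)"
  using \<open>finite S\<close> \<open>S \<subseteq> F\<close>
proof (induction S)
  case empty
  then show ?case using x0 reg by auto
next
  case (insert T S)
  then obtain w where w: "w \<in> X" "\<And>U. U \<in> F \<Longrightarrow> asymptotically_regular_at U w"
      "\<And>U. U \<in> S \<Longrightarrow> norm (U w - w) \<le> e"
    by auto
  have T: "T \<in> F" using insert.prems by simp
  have "\<forall>\<^sub>F n in sequentially. norm ((T ^^ n) w - (T ^^ Suc n) w) < e"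
    using w(2)[OF T] e unfolding asymptotically_regular_at_def by (rule order_tendstoD(2))
  then obtain n where n: "norm ((T ^^ n) w - (T ^^ Suc n) w) < e"
    using eventually_happens'[OF sequentially_bot] by blast
  define V where "V = T ^^ n"
  have V: "nonexpansive V" unfolding V_def by (intro nonexpansive_funpow nonexp T)
  have commV: "U (V x) = V (U x)" if "U \<in> F" for U x
  proof -
    have "T \<circ> U = U \<circ> T" using comm T that by (simp add: commuting_family_def)
    then show ?thesis unfolding V_def by (rule funpow_commute[symmetric])
  qed
  have "asymptotically_regular_at U (V w)" if "U \<in> F" for U
    by (rule asymptotically_regular_at_image[OF V _ w(2)[OF that]])
      (simp add: fun_eq_iff commV[OF that])
  moreover have "norm (T (V w) - V w) \<le> e"
    using n by (simp add: V_def norm_minus_commute)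
  moreover have "norm (U (V w) - V w) \<le> e" if "U \<in> S" for U
  proof -
    have "norm (U (V w) - V w) = norm (V (U w) - V w)"
      using commV[of U] that insert.prems by auto
    also have "\<dots> \<le> norm (U w - w)" by (rule nonexpansiveD[OF V])
    also have "\<dots> \<le> e" by (rule w(3)[OF that])
    finally show ?thesis .
  qed
  moreover have "V w \<in> X" unfolding V_def by (rule funpow_mem[OF inv[OF T] w(1)])
  ultimately show ?case by blast
qed

lemma internal_functional_approximately_subinvariant:
  assumes "nonexpansive T" "norm (T w - w) \<le> e"
  shows "internal_functional b w (T x) \<le> internal_functional b w x + e"
proof -
  have "norm (T x - w) \<le> norm (T x - T w) + norm (T w - w)"
    using norm_triangle_ineq[of "T x - T w" "T w - w"] by simp
  then show ?thesis
    using nonexpansiveD[OF assms(1), of x w] assms(2) by (simp add: internal_functional_def)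
qed

lemma compact_PiE_UNIV:
  fixes S :: "'i \<Rightarrow> 'b::topological_space set"
  assumes "\<And>i. compact (S i)"
  shows "compact (PiE UNIV S)"
  using assms compactin_PiE[of "\<lambda>_. euclidean" UNIV S]
  by (simp add: euclidean_product_topology)

lemma closed_PiE_UNIV:
  fixes S :: "'i \<Rightarrow> 'b::topological_space set"
  assumes "\<And>i. closed (S i)"
  shows "closed (PiE UNIV S)"
  using assms closedin_product_topology[of "\<lambda>_. euclidean" UNIV S]
  by (simp add: euclidean_product_topology)

text \<open>By the triangle inequality \<open>\<bar>\<parallel>x - w\<parallel> - \<parallel>b - w\<parallel>\<bar> \<le> \<parallel>x - b\<parallel>\<close>, uniformly in \<open>w\<close>, so all internal
  functionals lie in one product of compact intervals.\<close>

lemma compact_metric_functionals: "compact (metric_functionals b X)"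
proof -
  let ?K = "\<Pi>\<^sub>E x\<in>UNIV. {- norm (x - b)..norm (x - b)}"
  have K: "compact ?K" by (rule compact_PiE_UNIV) simp
  have "internal_functional b ` X \<subseteq> ?K"
  proof (clarsimp simp: PiE_UNIV_domain internal_functional_def)
    fix w x
    show "- norm (x - b) \<le> norm (x - w) - norm (b - w) \<and>
          norm (x - w) - norm (b - w) \<le> norm (x - b)"
      using norm_triangle_ineq3[of "x - w" "b - w"] by (simp add: abs_le_iff)
  qed
  moreover have "closed ?K" by (rule closed_PiE_UNIV) simp
  ultimately have "metric_functionals b X \<subseteq> ?K"
    unfolding metric_functionals_def by (rule closure_minimal)
  then have "metric_functionals b X = ?K \<inter> metric_functionals b X" by blast
  also have "compact \<dots>"
    using K by (intro compact_Int_closed) (simp_all add: metric_functionals_def)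
  finally show ?thesis .
qed

lemma closed_approximately_subinvariant:
  fixes T :: "'a \<Rightarrow> 'a"
  shows "closed {h :: 'a \<Rightarrow> real. \<forall>x. h (T x) \<le> h x + e}"
  by (intro closed_Collect_all closed_Collect_le continuous_intros continuous_on_product_coordinates)

theorem theorem3p3:
  fixes F :: "('a::banach \<Rightarrow> 'a) set"
    and X :: "'a set"
    and b x0 :: 'a
  assumes "commuting_family F"
    and "\<And>T. T \<in> F \<Longrightarrow> nonexpansive T"
    and "X \<noteq> {}"
    and "\<And>T. T \<in> F \<Longrightarrow> T ` X \<subseteq> X"
    and "x0 \<in> X"
    and "\<And>T. T \<in> F \<Longrightarrow> (\<lambda>n. norm ((T ^^ n) x0 - (T ^^ Suc n) x0)) \<longlonglongrightarrow> 0"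
  shows "\<exists>h \<in> metric_functionals b X. \<forall>T\<in>F. \<forall>x. h (T x) \<le> h x"
proof -
  define C where "C = (\<lambda>(T, e). {h :: 'a \<Rightarrow> real. \<forall>x. h (T x) \<le> h x + e})"
  have reg: "asymptotically_regular_at T x0" if "T \<in> F" for T
    using assms(6)[OF that] by (simp only: asymptotically_regular_at_def)
  have "metric_functionals b X \<inter> (\<Inter>p \<in> F \<times> {0<..}. C p) \<noteq> {}"
  proof (rule compact_imp_fip_image[OF compact_metric_functionals])
    show "closed (C p)" for p :: "('a \<Rightarrow> 'a) \<times> real"
      by (cases p) (simp add: C_def closed_approximately_subinvariant)
  next
    fix J :: "(('a \<Rightarrow> 'a) \<times> real) set"
    assume J: "finite J" "J \<subseteq> F \<times> {0<..}"
    \<comment> \<open>Adjoining \<open>1\<close> makes the minimum of the errors in \<open>J\<close> meaningful for empty \<open>J\<close>.\<close>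
    define e where "e = Min (insert 1 (snd ` J))"
    have e: "e > 0" using J by (auto simp: e_def)
    have "finite (fst ` J)" "fst ` J \<subseteq> F" using J by auto
    from common_approximate_fixed_point[OF assms(1,2,4,5) reg this e]
    obtain w where w: "w \<in> X" "\<forall>T \<in> fst ` J. norm (T w - w) \<le> e"
      by blast
    have "internal_functional b w \<in> C (T, d)" if "(T, d) \<in> J" for T d
    proof -
      have "T \<in> F" using J that by auto
      have "e \<le> d" using J that by (force simp: e_def intro: Min_le)
      moreover have "norm (T w - w) \<le> e" using w(2) that by force
      ultimately have "norm (T w - w) \<le> d" by simp
      then show ?thesis
        using internal_functional_approximately_subinvariant[OF assms(2)[OF \<open>T \<in> F\<close>]]
        by (simp add: C_def)
    qed
    moreover have "internal_functional b w \<in> metric_functionals b X"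
      unfolding metric_functionals_def by (rule subsetD[OF closure_subset imageI[OF w(1)]])
    ultimately show "metric_functionals b X \<inter> (\<Inter>p \<in> J. C p) \<noteq> {}" by auto
  qed
  then obtain h where h: "h \<in> metric_functionals b X"
      and sub: "\<And>T e x. T \<in> F \<Longrightarrow> e > 0 \<Longrightarrow> h (T x) \<le> h x + e"
    by (auto simp: C_def)
  have "h (T x) \<le> h x" if "T \<in> F" for T x
    by (rule field_le_epsilon) (rule sub[OF that])
  with h show ?thesis by blast
qed

end
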